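(* Let $\sigma\subseteq\tau$ be topologies on a set $X$, with $\tau$ regular and Baire. Let $\alpha\le\omega_1$ be an ordinal and let $(\tau_\xi)_{\xi\le\alpha}$ be a filtration from $\sigma$ to $\tau$ such that $\tau_\xi$ is metrizable for each $\xi<\alpha$ and $\tau_\alpha$ is Baire. If $\tau$ has a neighborhood basis consisting of sets belonging to $\bigcup_{\xi<\alpha}\mathbf\Pi^0_{1+\xi}$ with respect to $\sigma$, then $\tau_\alpha=\tau$.
   Context: No separability is assumed. A topology is Baire if every countable union of nowhere dense sets has dense complement. A neighborhood basis of $\tau$ is a family $\mathcal A$ of subsets of $X$ such that for each $x$ and each set $B$ containing $x$ in its $\tau$-interior there is $A\in\mathcal A$ with $x\in{\rm int}_\tau(A)$ and $A\subseteq B$. The classes $\mathbf\Pi^0_{1+\xi}$ with respect to $\sigma$: $\mathbf\Pi^0_1$ is the family of $\sigma$-closed sets, and for $\xi\ge1$, $\mathbf\Pi^0_{1+\xi}$ consists of the complements of countable unions of sets from $\bigcup_{\gamma<\xi}\mathbf\Pi^0_{1+\gamma}$. A sequence $(\tau_\xi)_{\xi\le\alpha}$ (i.e. indexed by $\xi<\alpha+1$) of topologies on $X$ is a filtration from $\sigma$ to $\tau$ if $\sigma=\tau_0\subseteq\tau_1\subseteq\cdots\subseteq\tau_\alpha\subseteq\tau$ and for each $\beta\le\alpha$, whenever $F$ is $\tau_\xi$-closed for some $\xi<\beta$, ${\rm int}_{\tau_\beta}(F)={\rm int}_\tau(F)$. *)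

theory Defs
  imports "HOL-Analysis.Analysis"
begin

text \<open>
  A topology on a set \<open>X\<close> is a value \<open>T\<close> of type \<open>'a topology\<close> with \<open>topspace T = X\<close>.

  Ordinals are elements of an arbitrary type \<open>'i\<close> of class \<open>wellorder\<close>: the element \<open>\<alpha>\<close> stands for
  the order type of \<open>{..<\<alpha>}\<close>, and the least element for the ordinal 0. Leaving \<open>'i\<close> free amounts to
  quantifying over all ordinals. The first uncountable ordinal is \<open>cardSuc natLeq\<close>.
\<close>

definition ord_below :: "'i::wellorder \<Rightarrow> 'i rel" where
  "ord_below \<alpha> = {(\<xi>, \<eta>). \<xi> \<le> \<eta> \<and> \<eta> < \<alpha>}"

definition le_omega1 :: "'i::wellorder \<Rightarrow> bool" where
  "le_omega1 \<alpha> \<longleftrightarrow> (ord_below \<alpha>, cardSuc natLeq) \<in> ordLeq"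

lemma Field_ord_below: "Field (ord_below \<alpha>) = {..<\<alpha>}"
  by (auto simp: ord_below_def Field_def)

lemma Well_order_ord_below: "Well_order (ord_below \<alpha>)"
proof -
  have "wf (ord_below \<alpha> - Id)"
    by (rule wf_subset[OF wf]) (auto simp: ord_below_def)
  then show ?thesis
    unfolding well_order_on_def linear_order_on_def partial_order_on_def preorder_on_def Field_ord_below
    by (auto simp: ord_below_def refl_on_def trans_def antisym_def total_on_def)
qed

definition coarser :: "'a topology \<Rightarrow> 'a topology \<Rightarrow> bool" where
  "coarser S T \<longleftrightarrow> topspace S = topspace T \<and> (\<forall>U. openin S U \<longrightarrow> openin T U)"

definition nowhere_dense_in :: "'a topology \<Rightarrow> 'a set \<Rightarrow> bool" where
  "nowhere_dense_in T N \<longleftrightarrow> N \<subseteq> topspace T \<and> T interior_of (T closure_of N) = {}"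

definition Baire_topology :: "'a topology \<Rightarrow> bool" where
  "Baire_topology T \<longleftrightarrow>
     (\<forall>\<N>. countable \<N> \<and> (\<forall>N\<in>\<N>. nowhere_dense_in T N) \<longrightarrow>
          T closure_of (topspace T - \<Union>\<N>) = topspace T)"

definition neighborhood_basis :: "'a topology \<Rightarrow> 'a set set \<Rightarrow> bool" where
  "neighborhood_basis T \<A> \<longleftrightarrow>
     (\<forall>A\<in>\<A>. A \<subseteq> topspace T) \<and>
     (\<forall>x B. B \<subseteq> topspace T \<and> x \<in> T interior_of B \<longrightarrow>
            (\<exists>A\<in>\<A>. x \<in> T interior_of A \<and> A \<subseteq> B))"

text \<open>\<open>Borel_Pi S \<xi>\<close> is the class with index \<open>1 + \<xi>\<close>; it consists of the closed sets for \<open>\<xi> = 0\<close>.\<close>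

function Borel_Pi :: "'a topology \<Rightarrow> 'i::wellorder \<Rightarrow> 'a set set" where
  "Borel_Pi S \<xi> =
     (if \<xi> = (LEAST \<zeta>. True) then {F. closedin S F}
      else {topspace S - \<Union>\<A> |\<A>. countable \<A> \<and> \<A> \<subseteq> (\<Union>\<gamma>\<in>{..<\<xi>}. Borel_Pi S \<gamma>)})"
  by auto
termination
  by (relation "inv_image {(x, y). x < y} snd") (auto intro: wf)

declare Borel_Pi.simps [simp del]

text \<open>Only the values \<open>T \<xi>\<close> with \<open>\<xi> \<le> \<alpha>\<close> matter.\<close>

definition topology_filtration ::
  "'a topology \<Rightarrow> 'a topology \<Rightarrow> 'i::wellorder \<Rightarrow> ('i \<Rightarrow> 'a topology) \<Rightarrow> bool" where
  "topology_filtration \<sigma> \<tau> \<alpha> T \<longleftrightarrow>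
     T (LEAST \<zeta>. True) = \<sigma> \<and>
     (\<forall>\<xi> \<eta>. \<xi> \<le> \<eta> \<and> \<eta> \<le> \<alpha> \<longrightarrow> coarser (T \<xi>) (T \<eta>)) \<and>
     coarser (T \<alpha>) \<tau> \<and>
     (\<forall>\<beta>\<le>\<alpha>. \<forall>\<xi><\<beta>. \<forall>F. closedin (T \<xi>) F \<longrightarrow> T \<beta> interior_of F = \<tau> interior_of F)"

end

theory Submission
  imports Defs
begin

text \<open>
  Modulo \<open>\<tau>\<close>-meager sets, a set of class \<open>\<Pi>\<close> with index \<open>1 + \<xi>\<close> is \<open>\<tau>\<^sub>\<xi>\<close>-closed: in the inductive
  step, the filtration property says that for \<open>\<gamma> < \<xi>\<close> a \<open>\<tau>\<^sub>\<gamma>\<close>-closed set differs from its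
  \<open>\<tau>\<^sub>\<xi>\<close>-interior by a \<open>\<tau>\<close>-nowhere dense set. Given \<open>x\<close> in a \<open>\<tau>\<close>-open \<open>U\<close>, choose by regularity a
  basic set \<open>A\<close> around \<open>x\<close> with \<open>\<tau>\<close>-closure inside \<open>U\<close>, and a \<open>\<tau>\<^sub>\<xi>\<close>-closed \<open>F\<close> equal to \<open>A\<close> modulo
  meager. As \<open>\<tau>\<close> is Baire, the \<open>\<tau>\<close>-interior of \<open>A\<close> is contained in \<open>F\<close>, and the \<open>\<tau>\<close>-interior of \<open>F\<close>
  is contained in the closure of \<open>A\<close>; the latter interior is \<open>\<tau>\<^sub>\<alpha>\<close>-open.
\<close>

text \<open>Asking only for a cover by nowhere dense sets, not for equality with their union, makes
  passing to subsets immediate.\<close>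

definition meager_in :: "'a topology \<Rightarrow> 'a set \<Rightarrow> bool" where
  "meager_in T M \<longleftrightarrow> (\<exists>\<N>. countable \<N> \<and> (\<forall>N\<in>\<N>. nowhere_dense_in T N) \<and> M \<subseteq> \<Union>\<N>)"

lemma meager_in_subset: "meager_in T M \<Longrightarrow> L \<subseteq> M \<Longrightarrow> meager_in T L"
  unfolding meager_in_def by (meson subset_trans)

lemma nowhere_dense_imp_meager_in: "nowhere_dense_in T N \<Longrightarrow> meager_in T N"
  unfolding meager_in_def by (rule exI[of _ "{N}"]) auto

lemma meager_in_UN:
  assumes "countable I" and "\<And>i. i \<in> I \<Longrightarrow> meager_in T (M i)"
  shows "meager_in T (\<Union>i\<in>I. M i)"
proof -
  obtain \<N> where \<N>: "\<And>i. i \<in> I \<Longrightarrow>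
      countable (\<N> i) \<and> (\<forall>N\<in>\<N> i. nowhere_dense_in T N) \<and> M i \<subseteq> \<Union>(\<N> i)"
    using assms(2) unfolding meager_in_def by metis
  show ?thesis
    unfolding meager_in_def
  proof (intro exI conjI)
    show "countable (\<Union>i\<in>I. \<N> i)"
      using assms(1) \<N> by blast
    show "\<forall>N\<in>(\<Union>i\<in>I. \<N> i). nowhere_dense_in T N"
      using \<N> by blast
    show "(\<Union>i\<in>I. M i) \<subseteq> \<Union>(\<Union>i\<in>I. \<N> i)"
      using \<N> by fastforce
  qed
qed

lemma meager_in_Un:
  assumes "meager_in T L" and "meager_in T M"
  shows "meager_in T (L \<union> M)"
  using meager_in_UN[of "{L, M}" T id] assms by auto

text \<open>The complement of the countable union covering \<open>U\<close> is dense, and an open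
  set that misses a dense set is empty.\<close>

lemma Baire_open_meager_empty:
  assumes "Baire_topology T" and "openin T U" and "meager_in T U"
  shows "U = {}"
proof -
  obtain \<N> where \<N>: "countable \<N>" "\<forall>N\<in>\<N>. nowhere_dense_in T N" "U \<subseteq> \<Union>\<N>"
    using assms(3) unfolding meager_in_def by blast
  then have "T closure_of (topspace T - \<Union>\<N>) = topspace T"
    using assms(1) unfolding Baire_topology_def by blast
  moreover have "U \<inter> (topspace T - \<Union>\<N>) = {}"
    using \<N>(3) by blast
  ultimately show ?thesis
    using openin_Int_closure_of_eq_empty[OF assms(2)] openin_subset[OF assms(2)] by (metis inf.absorb1)
qed

text \<open>The difference is closed, so only its own interior matters; that interior lies in the
  interior of \<open>F\<close>, which the difference avoids.\<close>

lemma closedin_diff_interior_nowhere_dense: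
  assumes "closedin T F"
  shows "nowhere_dense_in T (F - T interior_of F)"
proof -
  have cl: "closedin T (F - T interior_of F)"
    by (simp add: assms closedin_diff)
  have "T interior_of (F - T interior_of F) \<subseteq> T interior_of F - T interior_of F"
    using interior_of_mono[of "F - T interior_of F" F T]
      interior_of_subset[of T "F - T interior_of F"] by blast
  then show ?thesis
    unfolding nowhere_dense_in_def using cl closedin_subset[OF cl] by (simp add: closure_of_closedin)
qed

lemma coarser_closedin: "coarser S T \<Longrightarrow> closedin S F \<Longrightarrow> closedin T F"
  unfolding coarser_def closedin_def by auto

text \<open>Closedness refers to the level \<xi>, but meagerness always to \<tau>, so the errors
  from countably many lower levels add up to a single meager set.\<close>

lemma Borel_Pi_eq_closed_mod_meager:
  fixes \<alpha> :: "'i::wellorder"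
  assumes filt: "topology_filtration \<sigma> \<tau> \<alpha> T"
    and "\<xi> \<le> \<alpha>" and "A \<in> Borel_Pi \<sigma> \<xi>"
  shows "\<exists>F. closedin (T \<xi>) F \<and> meager_in \<tau> ((A - F) \<union> (F - A))"
  using assms(2,3)
proof (induction \<xi> arbitrary: A rule: less_induct)
  case (less \<xi>)
  have T0: "T (LEAST \<zeta>. True) = \<sigma>"
    and mono: "\<And>\<xi> \<eta>. \<xi> \<le> \<eta> \<Longrightarrow> \<eta> \<le> \<alpha> \<Longrightarrow> coarser (T \<xi>) (T \<eta>)"
    and top: "coarser (T \<alpha>) \<tau>"
    and int: "\<And>\<beta> \<xi> F. \<beta> \<le> \<alpha> \<Longrightarrow> \<xi> < \<beta> \<Longrightarrow> closedin (T \<xi>) F \<Longrightarrow>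
        T \<beta> interior_of F = \<tau> interior_of F"
    using filt unfolding topology_filtration_def by auto
  show ?case
  proof (cases "\<xi> = (LEAST \<zeta>. True)")
    case True
    then have "closedin (T \<xi>) A"
      using less.prems(2) T0 by (simp add: Borel_Pi.simps[of \<sigma> "LEAST \<zeta>. True"])
    moreover have "meager_in \<tau> ((A - A) \<union> (A - A))"
      unfolding meager_in_def by (rule exI[of _ "{}"]) auto
    ultimately show ?thesis by blast
  next
    case False
    then obtain \<A> where \<A>: "countable \<A>" "\<A> \<subseteq> (\<Union>\<gamma>\<in>{..<\<xi>}. Borel_Pi \<sigma> \<gamma>)"
      and A: "A = topspace \<sigma> - \<Union>\<A>"
      using less.prems(2) by (auto simp: Borel_Pi.simps[of \<sigma> \<xi>])
    have "\<exists>\<gamma> F. \<gamma> < \<xi> \<and> closedin (T \<gamma>) F \<and> meager_in \<tau> ((B - F) \<union> (F - B))" if "B \<in> \<A>" for B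
    proof -
      obtain \<gamma> where "\<gamma> < \<xi>" "B \<in> Borel_Pi \<sigma> \<gamma>"
        using \<A>(2) \<open>B \<in> \<A>\<close> by blast
      then show ?thesis
        using less.IH[of \<gamma> B] less.prems(1) by force
    qed
    then obtain \<gamma> F where F: "\<And>B. B \<in> \<A> \<Longrightarrow> \<gamma> B < \<xi>"
        "\<And>B. B \<in> \<A> \<Longrightarrow> closedin (T (\<gamma> B)) (F B)"
        "\<And>B. B \<in> \<A> \<Longrightarrow> meager_in \<tau> ((B - F B) \<union> (F B - B))"
      by metis
    \<comment> \<open>The sets \<open>F B\<close> are closed at various levels below \<xi>; their
      interiors are all open in the one topology \<open>T \<xi>\<close>, so the complement of their
      union is closed there.\<close>
    define U where "U B = T \<xi> interior_of F B" for B
    have U: "U B \<subseteq> F B" for B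
      unfolding U_def by (rule interior_of_subset)
    have "nowhere_dense_in \<tau> (F B - U B)" if "B \<in> \<A>" for B
    proof -
      have "U B = \<tau> interior_of F B"
        unfolding U_def using int[OF less.prems(1) F(1,2)] that by blast
      moreover have "closedin \<tau> (F B)"
        using F(1,2)[OF that] mono[of "\<gamma> B" \<alpha>] less.prems(1) top coarser_closedin
        by (meson less_imp_le order.trans order_refl)
      ultimately show ?thesis
        using closedin_diff_interior_nowhere_dense by metis
    qed
    then have "meager_in \<tau> (((B - F B) \<union> (F B - B)) \<union> (F B - U B))" if "B \<in> \<A>" for B
      using that F(3) by (metis meager_in_Un nowhere_dense_imp_meager_in)
    then have meager: "meager_in \<tau> (\<Union>B\<in>\<A>. ((B - F B) \<union> (F B - B)) \<union> (F B - U B))"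
      using \<A>(1) by (rule meager_in_UN[rotated])
    define G where "G = topspace (T \<xi>) - (\<Union>B\<in>\<A>. U B)"
    have "topspace (T \<xi>) = topspace \<sigma>"
      using mono[of "LEAST \<zeta>. True" \<xi>] T0 less.prems(1) by (auto simp: coarser_def Least_le)
    \<comment> \<open>\<open>A\<close> and \<open>G\<close> are complements in the same space, so
      each point of their difference separates some \<open>B\<close> from
      \<open>U B\<close>.\<close>
    then have "(A - G) \<union> (G - A) \<subseteq> (\<Union>B\<in>\<A>. ((B - F B) \<union> (F B - B)) \<union> (F B - U B))"
      unfolding A G_def using U by blast
    moreover have "closedin (T \<xi>) G"
      unfolding G_def U_def by (intro closedin_diff closedin_topspace openin_Union) auto
    ultimately show ?thesis
      using meager meager_in_subset by blast
  qed
qed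

theorem theorem4p1:
  fixes X :: "'a set" and \<sigma> \<tau> :: "'a topology"
    and \<alpha> :: "'i::wellorder" and T :: "'i \<Rightarrow> 'a topology"
  assumes "topspace \<sigma> = X" and "topspace \<tau> = X"
    and "coarser \<sigma> \<tau>"
    and "regular_space \<tau>" and "Baire_topology \<tau>"
    and "le_omega1 \<alpha>"
    and "topology_filtration \<sigma> \<tau> \<alpha> T"
    and "\<And>\<xi>. \<xi> < \<alpha> \<Longrightarrow> metrizable_space (T \<xi>)"
    and "Baire_topology (T \<alpha>)"
    and "\<exists>\<A>. neighborhood_basis \<tau> \<A> \<and> \<A> \<subseteq> (\<Union>\<xi>\<in>{..<\<alpha>}. Borel_Pi \<sigma> \<xi>)"
  shows "T \<alpha> = \<tau>"
proof -
  obtain \<A> where basis: "neighborhood_basis \<tau> \<A>"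
    and \<A>: "\<A> \<subseteq> (\<Union>\<xi>\<in>{..<\<alpha>}. Borel_Pi \<sigma> \<xi>)"
    using assms(10) by blast
  have top: "coarser (T \<alpha>) \<tau>"
    and int: "\<And>\<xi> F. \<xi> < \<alpha> \<Longrightarrow> closedin (T \<xi>) F \<Longrightarrow> T \<alpha> interior_of F = \<tau> interior_of F"
    using assms(7) unfolding topology_filtration_def by auto
  have "\<exists>W. openin (T \<alpha>) W \<and> x \<in> W \<and> W \<subseteq> U" if U: "openin \<tau> U" "x \<in> U" for U x
  proof -
    obtain V C where V: "openin \<tau> V" "closedin \<tau> C" "x \<in> V" "V \<subseteq> C" "C \<subseteq> U"
      using assms(4) U unfolding neighbourhood_base_of_closedin[symmetric] neighbourhood_base_of
      by meson
    obtain A where A: "A \<in> \<A>" "x \<in> \<tau> interior_of A" "A \<subseteq> V"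
      using basis V(1,3) unfolding neighborhood_basis_def
      by (metis interior_of_openin openin_subset)
    obtain \<xi> where \<xi>: "\<xi> < \<alpha>" "A \<in> Borel_Pi \<sigma> \<xi>"
      using \<A> A(1) by blast
    obtain F where F: "closedin (T \<xi>) F" and meager: "meager_in \<tau> ((A - F) \<union> (F - A))"
      using Borel_Pi_eq_closed_mod_meager[OF assms(7) less_imp_le[OF \<xi>(1)] \<xi>(2)] by blast
    have "coarser (T \<xi>) (T \<alpha>)"
      using assms(7) \<xi>(1) unfolding topology_filtration_def by auto
    then have F\<tau>: "closedin \<tau> F"
      using F top coarser_closedin by metis
    have "\<tau> interior_of A - F = {}"
    proof (rule Baire_open_meager_empty[OF assms(5)])
      show "openin \<tau> (\<tau> interior_of A - F)"
        by (simp add: F\<tau> openin_diff)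
      show "meager_in \<tau> (\<tau> interior_of A - F)"
        by (rule meager_in_subset[OF meager]) (use interior_of_subset[of \<tau> A] in blast)
    qed
    then have "x \<in> \<tau> interior_of F"
      using A(2) interior_of_maximal[of "\<tau> interior_of A" F \<tau>] by auto
    \<comment> \<open>The closed set \<open>C\<close> stands in for the closure of \<open>A\<close>:
      since \<open>A\<close> lies in \<open>C\<close>, points of \<open>F\<close> outside
      \<open>C\<close> belong to the meager set \<open>F - A\<close>.\<close>
    moreover have "\<tau> interior_of F - C = {}"
    proof (rule Baire_open_meager_empty[OF assms(5)])
      show "openin \<tau> (\<tau> interior_of F - C)"
        by (simp add: V(2) openin_diff)
      show "meager_in \<tau> (\<tau> interior_of F - C)"
        by (rule meager_in_subset[OF meager]) (use interior_of_subset[of \<tau> F] A(3) V(4) in blast)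
    qed
    \<comment> \<open>As \<xi> is strictly below \<alpha>, the filtration property at \<alpha> turns
      this \<tau>-interior into a \<open>T \<alpha>\<close>-interior.\<close>
    moreover have "openin (T \<alpha>) (\<tau> interior_of F)"
      using int[OF \<xi>(1) F] openin_interior_of by metis
    ultimately show ?thesis
      using V(5) by blast
  qed
  then have "openin (T \<alpha>) U" if "openin \<tau> U" for U
    using that by (subst openin_subopen) blast
  then show ?thesis
    using top unfolding coarser_def topology_eq by blast
qed

end
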